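(* Let $(X_\alpha)_{\alpha\in A}$ be an indexed family of topological spaces, each having a countable Pytkeev network. If $|A|\le\aleph_0$, then the Tychonoff product $\prod_{\alpha\in A}X_\alpha$ has a countable Pytkeev network.
   Context: A subset $A$ of a topological space $X$ accumulates at a point $x\in X$ if each neighborhood of $x$ contains infinitely many points of $A$. A family $\mathcal N$ of subsets of $X$ is a network at $x\in X$ if for any neighborhood $O_x$ of $x$ there is $N\in\mathcal N$ with $x\in N\subset O_x$. It is a Pytkeev network at $x$ if it is a network at $x$ and for each neighborhood $O_x$ of $x$ and each subset $A\subset X$ accumulating at $x$ there is $N\in\mathcal N$ such that $N\subset O_x$ and $N\cap A$ is infinite. It is a Pytkeev network for $X$ if it is a Pytkeev network at each point $x\in X$. *)

theory Defs
  imports "HOL-Analysis.Analysis"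
begin

text \<open>Neighborhoods are not required to be open.\<close>

definition neighborhood_of :: "'a topology \<Rightarrow> 'a \<Rightarrow> 'a set \<Rightarrow> bool" where
  "neighborhood_of X x V \<longleftrightarrow>
     V \<subseteq> topspace X \<and> (\<exists>U. openin X U \<and> x \<in> U \<and> U \<subseteq> V)"

text \<open>
  The ambient conditions \<open>A \<subseteq> X\<close> and \<open>x \<in> X\<close> are imposed where the
  notions below are used, in \<open>Pytkeev_network_at\<close> and \<open>Pytkeev_network\<close>. No separation
  axiom is assumed, so accumulation counts points of \<open>A\<close> in each neighborhood; this is
  in general stronger than \<open>x \<in> X derived_set_of A\<close>.
\<close>

definition accumulates_at :: "'a topology \<Rightarrow> 'a set \<Rightarrow> 'a \<Rightarrow> bool" where
  "accumulates_at X A x \<longleftrightarrow> (\<forall>V. neighborhood_of X x V \<longrightarrow> infinite (V \<inter> A))"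

definition network_at :: "'a topology \<Rightarrow> 'a set set \<Rightarrow> 'a \<Rightarrow> bool" where
  "network_at X \<N> x \<longleftrightarrow>
     (\<forall>V. neighborhood_of X x V \<longrightarrow> (\<exists>N\<in>\<N>. x \<in> N \<and> N \<subseteq> V))"

definition Pytkeev_network_at :: "'a topology \<Rightarrow> 'a set set \<Rightarrow> 'a \<Rightarrow> bool" where
  "Pytkeev_network_at X \<N> x \<longleftrightarrow>
     network_at X \<N> x \<and>
     (\<forall>V A. neighborhood_of X x V \<and> A \<subseteq> topspace X \<and> accumulates_at X A x
        \<longrightarrow> (\<exists>N\<in>\<N>. N \<subseteq> V \<and> infinite (N \<inter> A)))"

definition Pytkeev_network :: "'a topology \<Rightarrow> 'a set set \<Rightarrow> bool" where
  "Pytkeev_network X \<N> \<longleftrightarrow>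
     \<N> \<subseteq> Pow (topspace X) \<and> (\<forall>x\<in>topspace X. Pytkeev_network_at X \<N> x)"

end

theory Submission
  imports Defs
begin

text \<open>
  The countable family that works for the product consists of the cylinders over finitely many
  coordinates whose sides are \<^emph>\<open>finite unions\<close> of members of the given networks.

  To see why finite unions are what is needed, fix an open set \<open>U\<close> in one factor \<open>X\<close>, a point \<open>x\<close> of
  \<open>U\<close>, and enumerate the members of the network that lie in \<open>U\<close>. They cover \<open>U\<close>; let the rank
  \<open>r y\<close> of \<open>y\<close> in \<open>U\<close> be the index of the first member containing \<open>y\<close>. The sublevel sets of \<open>r\<close> are
  finite unions of network members, and the Pytkeev property says that \<open>r\<close> is bounded on an infinite
  part of every set accumulating at \<open>x\<close> (lemma \<open>Pytkeev_network_rank\<close>).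

  In the product, a neighborhood of \<open>x\<close> contains a box that restricts a finite set \<open>F\<close> of coordinates
  to open sets \<open>U i\<close>, with ranks \<open>r i\<close>. Let \<open>B\<close> be a subset of the box that accumulates at \<open>x\<close>. It
  suffices to find an infinite part of \<open>B\<close> on which all the ranks are bounded by one \<open>n\<close>
  (lemma \<open>common_rank_bound\<close>). Coordinate projections need not preserve accumulation, since they can
  have infinite fibers, so the argument is by contradiction: suppose only finitely many points of \<open>B\<close>
  have all ranks at most \<open>n\<close>, for each \<open>n\<close>. Split \<open>B\<close> according to which coordinate has
  the largest rank. One of the finitely many pieces still accumulates at \<open>x\<close>, say the one where
  coordinate \<open>i\<close> dominates. On that piece a bound on the rank of coordinate \<open>i\<close> bounds all the
  ranks, hence leaves only finitely many points. So the \<open>i\<close>-th projection has finite fibers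
  there, its image accumulates at \<open>x i\<close>, and yet the rank is bounded on no infinite part of the
  image: a contradiction.
\<close>

section \<open>Accumulation\<close>

lemma accumulates_at_iff_openin:
  "accumulates_at X A x \<longleftrightarrow> (\<forall>U. openin X U \<and> x \<in> U \<longrightarrow> infinite (U \<inter> A))"
proof
  assume *: "accumulates_at X A x"
  show "\<forall>U. openin X U \<and> x \<in> U \<longrightarrow> infinite (U \<inter> A)"
    using * openin_subset unfolding accumulates_at_def neighborhood_of_def by blast
next
  assume *: "\<forall>U. openin X U \<and> x \<in> U \<longrightarrow> infinite (U \<inter> A)"
  show "accumulates_at X A x"
    unfolding accumulates_at_def neighborhood_of_def
  proof (intro allI impI)
    fix V assume "V \<subseteq> topspace X \<and> (\<exists>U. openin X U \<and> x \<in> U \<and> U \<subseteq> V)"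
    then obtain U where "openin X U" "x \<in> U" "U \<subseteq> V" by blast
    with * have "infinite (U \<inter> A)" "U \<inter> A \<subseteq> V \<inter> A" by blast+
    then show "infinite (V \<inter> A)" using infinite_super by blast
  qed
qed

lemma accumulates_at_Int_openin:
  assumes "accumulates_at X A x" "openin X U" "x \<in> U"
  shows "accumulates_at X (A \<inter> U) x"
  unfolding accumulates_at_iff_openin
proof (intro allI impI)
  fix W assume "openin X W \<and> x \<in> W"
  then have "openin X (W \<inter> U)" "x \<in> W \<inter> U" using assms by auto
  then have "infinite ((W \<inter> U) \<inter> A)" using assms(1) unfolding accumulates_at_iff_openin by blast
  then show "infinite (W \<inter> (A \<inter> U))" by (simp add: Int_ac)
qed

text \<open>
  If every piece failed at some open neighborhood of \<open>x\<close>, the union would fail at their intersection.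
\<close>

lemma accumulates_at_finite_UN:
  assumes "finite F" "F \<noteq> {}" "accumulates_at X (\<Union>i\<in>F. B i) x"
  shows "\<exists>i\<in>F. accumulates_at X (B i) x"
proof (rule ccontr)
  assume "\<not> ?thesis"
  then have "\<forall>i\<in>F. \<exists>U. openin X U \<and> x \<in> U \<and> finite (U \<inter> B i)"
    unfolding accumulates_at_iff_openin by blast
  then obtain U where U: "\<And>i. i \<in> F \<Longrightarrow> openin X (U i) \<and> x \<in> U i \<and> finite (U i \<inter> B i)"
    by metis
  define W where "W = (\<Inter>i\<in>F. U i)"
  have "openin X W" unfolding W_def using assms U by (intro openin_INT2) auto
  moreover have "x \<in> W" unfolding W_def using U by blast
  ultimately have "infinite (W \<inter> (\<Union>i\<in>F. B i))"
    using assms(3) unfolding accumulates_at_iff_openin by blast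
  moreover have "W \<inter> (\<Union>i\<in>F. B i) \<subseteq> (\<Union>i\<in>F. U i \<inter> B i)" unfolding W_def by blast
  moreover have "finite (\<Union>i\<in>F. U i \<inter> B i)" using assms(1) U by blast
  ultimately show False using finite_subset by blast
qed

text \<open>
  The preimage of a neighborhood of \<open>f z\<close> contains infinitely many points of \<open>B\<close>; finite fibers
  keep them from collapsing to finitely many values, as they would under a constant map.
\<close>

lemma accumulates_at_image:
  assumes f: "continuous_map Z X f" and z: "z \<in> topspace Z"
    and B: "B \<subseteq> topspace Z" "accumulates_at Z B z"
    and fibers: "\<And>y. finite {b \<in> B. f b = y}"
  shows "accumulates_at X (f ` B) (f z)"
  unfolding accumulates_at_iff_openin
proof (intro allI impI)
  fix W assume W: "openin X W \<and> f z \<in> W"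
  define C where "C = {b \<in> B. f b \<in> W}"
  have "openin Z {b \<in> topspace Z. f b \<in> W}"
    using f W openin_continuous_map_preimage by blast
  then have "infinite ({b \<in> topspace Z. f b \<in> W} \<inter> B)"
    using B(2) W z unfolding accumulates_at_iff_openin by blast
  moreover have "{b \<in> topspace Z. f b \<in> W} \<inter> B = C" using B(1) unfolding C_def by blast
  ultimately have "infinite C" by simp
  have "infinite (f ` C)"
  proof
    assume "finite (f ` C)"
    then obtain c where "infinite {b \<in> C. f b = f c}"
      using pigeonhole_infinite[OF \<open>infinite C\<close>] by blast
    moreover have "{b \<in> C. f b = f c} \<subseteq> {b \<in> B. f b = f c}" unfolding C_def by blast
    ultimately show False using fibers finite_subset by blast
  qed
  moreover have "f ` C \<subseteq> W \<inter> f ` B" unfolding C_def by blast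
  ultimately show "infinite (W \<inter> f ` B)" using infinite_super by blast
qed

section \<open>Rank functions\<close>

definition finite_unions :: "'a set set \<Rightarrow> 'a set set" where
  "finite_unions \<N> = Union ` {\<F>. finite \<F> \<and> \<F> \<subseteq> \<N>}"

lemma countable_finite_unions: "countable \<N> \<Longrightarrow> countable (finite_unions \<N>)"
  unfolding finite_unions_def by (intro countable_image countable_Collect_finite_subset)

lemma mem_finite_unions: "N \<in> \<N> \<Longrightarrow> N \<in> finite_unions \<N>"
  unfolding finite_unions_def by (rule image_eqI[of _ _ "{N}"]) auto

text \<open>
  The Pytkeev property enters the argument for infinite intersections only through such an \<open>r\<close>
  whose sublevel sets in \<open>U\<close> are finite unions of network members.
  Only the values of \<open>r\<close> on \<open>U\<close> matter.
\<close>

definition Pytkeev_rank :: "'a topology \<Rightarrow> 'a set \<Rightarrow> 'a \<Rightarrow> ('a \<Rightarrow> nat) \<Rightarrow> bool" where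
  "Pytkeev_rank X U x r \<longleftrightarrow>
     (\<forall>A. A \<subseteq> U \<and> accumulates_at X A x \<longrightarrow> (\<exists>n. infinite {y \<in> A. r y \<le> n}))"

lemma Pytkeev_network_rank:
  assumes \<N>: "countable \<N>" "Pytkeev_network X \<N>" and U: "openin X U" "x \<in> U"
  obtains r where "Pytkeev_rank X U x r" "\<And>n. {y \<in> U. r y \<le> n} \<in> finite_unions \<N>"
proof -
  define \<M> where "\<M> = {N \<in> \<N>. N \<subseteq> U}"
  have UX: "U \<subseteq> topspace X" using U openin_subset by blast
  have nbhd: "neighborhood_of X y U" if "y \<in> U" for y
    using U(1) UX that unfolding neighborhood_of_def by blast
  have net: "Pytkeev_network_at X \<N> y" if "y \<in> U" for y
    using \<N>(2) UX that unfolding Pytkeev_network_def by blast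
  have cover: "\<exists>N\<in>\<M>. y \<in> N" if "y \<in> U" for y
    using net[OF that] nbhd[OF that] unfolding Pytkeev_network_at_def network_at_def \<M>_def by blast
  have "\<M> \<subseteq> \<N>" unfolding \<M>_def by blast
  then have \<M>: "countable \<M>" "\<M> \<noteq> {}"
    using \<N>(1) countable_subset cover[OF U(2)] by blast+
  define e where "e = from_nat_into \<M>"
  have range_e: "range e = \<M>" unfolding e_def using \<M>(2,1) by (rule range_from_nat_into)
  define r where "r y = (LEAST n. y \<in> e n)" for y
  have r: "y \<in> e (r y)" if "y \<in> U" for y
  proof -
    obtain n where "y \<in> e n" using cover[OF \<open>y \<in> U\<close>] range_e by blast
    then show ?thesis unfolding r_def by (rule LeastI)
  qed
  have e: "e n \<in> \<N>" "e n \<subseteq> U" for n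
  proof -
    have "e n \<in> \<M>" using range_e by blast
    then show "e n \<in> \<N>" "e n \<subseteq> U" unfolding \<M>_def by blast+
  qed
  have r_le: "r y \<le> n" if "y \<in> e n" for y n
    using that unfolding r_def by (rule Least_le)
  have sublevel: "{y \<in> U. r y \<le> n} = \<Union> (e ` {..n})" for n
  proof
    show "{y \<in> U. r y \<le> n} \<subseteq> \<Union> (e ` {..n})" using r by blast
    show "\<Union> (e ` {..n}) \<subseteq> {y \<in> U. r y \<le> n}" using e(2) r_le by fastforce
  qed
  have "{y \<in> U. r y \<le> n} \<in> finite_unions \<N>" for n
  proof -
    have "e ` {..n} \<subseteq> \<N>" using e(1) by blast
    then show ?thesis unfolding sublevel finite_unions_def by auto
  qed
  moreover have "Pytkeev_rank X U x r"
    unfolding Pytkeev_rank_def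
  proof (intro allI impI)
    fix A assume A: "A \<subseteq> U \<and> accumulates_at X A x"
    then obtain N where N: "N \<in> \<N>" "N \<subseteq> U" "infinite (N \<inter> A)"
      using net[OF U(2)] nbhd[OF U(2)] UX unfolding Pytkeev_network_at_def by blast
    then have "N \<in> range e" unfolding range_e \<M>_def by blast
    then obtain n where "N = e n" by blast
    then have "N \<inter> A \<subseteq> {y \<in> A. r y \<le> n}" using r_le by blast
    then show "\<exists>n. infinite {y \<in> A. r y \<le> n}" using N(3) infinite_super by blast
  qed
  ultimately show thesis using that by blast
qed

text \<open>
  The piece of \<open>B\<close> on which coordinate \<open>i\<close> has the largest rank has the property that bounding that
  one rank bounds them all. Under the assumption to be refuted this forces the fibers of \<open>f i\<close> on
  the piece to be finite, which is what carries accumulation over to \<open>X i\<close>.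
\<close>

lemma common_rank_bound:
  assumes z: "z \<in> topspace Z" and B: "B \<subseteq> topspace Z" "accumulates_at Z B z"
    and F: "finite F" "F \<noteq> {}"
    and f: "\<And>i. i \<in> F \<Longrightarrow> continuous_map Z (X i) (f i)"
    and fB: "\<And>i. i \<in> F \<Longrightarrow> f i ` B \<subseteq> U i"
    and rank: "\<And>i. i \<in> F \<Longrightarrow> Pytkeev_rank (X i) (U i) (f i z) (r i)"
  shows "\<exists>n. infinite {b \<in> B. \<forall>i\<in>F. r i (f i b) \<le> n}"
proof (rule ccontr)
  assume "\<not> ?thesis"
  then have fin: "finite {b \<in> B. \<forall>i\<in>F. r i (f i b) \<le> n}" for n by blast
  define D where "D i = {b \<in> B. \<forall>j\<in>F. r j (f j b) \<le> r i (f i b)}" for i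
  have D_bound: "finite {b \<in> D i. r i (f i b) \<le> n}" for i n
  proof (rule finite_subset[OF _ fin[of n]])
    show "{b \<in> D i. r i (f i b) \<le> n} \<subseteq> {b \<in> B. \<forall>i\<in>F. r i (f i b) \<le> n}"
      unfolding D_def using order_trans by blast
  qed
  have "B = (\<Union>i\<in>F. D i)"
  proof
    show "B \<subseteq> (\<Union>i\<in>F. D i)"
    proof
      fix b assume "b \<in> B"
      define R where "R = (\<lambda>i. r i (f i b)) ` F"
      have "finite R" "R \<noteq> {}" unfolding R_def using F by auto
      then have "Max R \<in> R" "\<forall>j\<in>F. r j (f j b) \<le> Max R" unfolding R_def by auto
      then obtain i where "i \<in> F" "\<forall>j\<in>F. r j (f j b) \<le> r i (f i b)" unfolding R_def by auto
      with \<open>b \<in> B\<close> show "b \<in> (\<Union>i\<in>F. D i)" unfolding D_def by blast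
    qed
  qed (auto simp: D_def)
  then obtain i where i: "i \<in> F" "accumulates_at Z (D i) z"
    using accumulates_at_finite_UN[OF F] B(2) by metis
  have DB: "D i \<subseteq> B" unfolding D_def by blast
  have "finite {b \<in> D i. f i b = y}" for y
    by (rule finite_subset[OF _ D_bound[of i "r i y"]]) auto
  then have "accumulates_at (X i) (f i ` D i) (f i z)"
    using accumulates_at_image[OF f[OF i(1)] z _ i(2)] DB B(1) by blast
  moreover have "f i ` D i \<subseteq> U i" using fB[OF i(1)] DB by blast
  ultimately obtain n where "infinite {y \<in> f i ` D i. r i y \<le> n}"
    using rank[OF i(1)] unfolding Pytkeev_rank_def by blast
  moreover have "{y \<in> f i ` D i. r i y \<le> n} \<subseteq> f i ` {b \<in> D i. r i (f i b) \<le> n}" by blast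
  ultimately show False using D_bound finite_surj by blast
qed

section \<open>Cylinders in the product\<close>

definition cylinder :: "('i \<Rightarrow> 'a topology) \<Rightarrow> 'i set \<Rightarrow> 'i set \<Rightarrow> ('i \<Rightarrow> 'a set) \<Rightarrow> ('i \<Rightarrow> 'a) set"
  where "cylinder X I F M = {g \<in> topspace (product_topology X I). \<forall>i\<in>F. g i \<in> M i}"

text \<open>
  Side functions range over \<open>PiE\<close> because there they are determined by their values
  on the finite set \<open>F\<close>, which keeps their number countable.
\<close>

definition finite_cylinders ::
  "('i \<Rightarrow> 'a topology) \<Rightarrow> 'i set \<Rightarrow> ('i \<Rightarrow> 'a set set) \<Rightarrow> ('i \<Rightarrow> 'a) set set" where
  "finite_cylinders X I \<S> = (\<Union>F\<in>{F. finite F \<and> F \<subseteq> I}. cylinder X I F ` PiE F \<S>)"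

lemma countable_finite_cylinders:
  assumes "countable I" "\<And>i. i \<in> I \<Longrightarrow> countable (\<S> i)"
  shows "countable (finite_cylinders X I \<S>)"
  unfolding finite_cylinders_def
  using assms by (intro countable_UN countable_Collect_finite_subset countable_image countable_PiE) auto

lemma cylinder_mem_finite_cylinders:
  assumes "finite F" "F \<subseteq> I" "\<And>i. i \<in> F \<Longrightarrow> M i \<in> \<S> i"
  shows "cylinder X I F M \<in> finite_cylinders X I \<S>"
proof -
  have "cylinder X I F M = cylinder X I F (restrict M F)" unfolding cylinder_def by auto
  moreover have "restrict M F \<in> PiE F \<S>" using assms(3) by auto
  ultimately show ?thesis unfolding finite_cylinders_def using assms(1,2) by blast
qed

lemma neighborhood_of_product_cylinder:
  assumes "neighborhood_of (product_topology X I) x V"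
  obtains F U where "finite F" "F \<subseteq> I" "\<And>i. i \<in> F \<Longrightarrow> openin (X i) (U i)"
    "x \<in> cylinder X I F U" "cylinder X I F U \<subseteq> V" "openin (product_topology X I) (cylinder X I F U)"
proof -
  obtain W where W: "openin (product_topology X I) W" "x \<in> W" "W \<subseteq> V"
    using assms unfolding neighborhood_of_def by blast
  then have "\<exists>U. finite {i \<in> I. U i \<noteq> topspace (X i)} \<and> (\<forall>i\<in>I. openin (X i) (U i)) \<and>
      x \<in> Pi\<^sub>E I U \<and> Pi\<^sub>E I U \<subseteq> W"
    unfolding openin_product_topology_alt by (elim bspec)
  then obtain U where U: "finite {i \<in> I. U i \<noteq> topspace (X i)}" "\<forall>i\<in>I. openin (X i) (U i)"
    "x \<in> Pi\<^sub>E I U" "Pi\<^sub>E I U \<subseteq> V"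
    using W(3) by (elim exE conjE) (rule that, assumption+, rule subset_trans)
  define F where "F = {i \<in> I. U i \<noteq> topspace (X i)}"
  have "g i \<in> topspace (X i)" if "i \<in> I" "g i \<in> U i" for g i
    using U(2) that openin_subset by blast
  then have *: "cylinder X I F U = Pi\<^sub>E I U"
    unfolding cylinder_def F_def topspace_product_topology by (auto simp: PiE_iff extensional_def)
  show thesis
  proof
    show "finite F" "F \<subseteq> I" using U(1) unfolding F_def by auto
    show "openin (X i) (U i)" if "i \<in> F" for i using U(2) that unfolding F_def by blast
    show "openin (product_topology X I) (cylinder X I F U)"
      using U(1,2) unfolding * openin_PiE_gen by blast
  qed (simp_all add: * U(3,4))
qed

lemma Pytkeev_network_product:
  assumes "\<And>i. i \<in> I \<Longrightarrow> countable (\<N> i)" "\<And>i. i \<in> I \<Longrightarrow> Pytkeev_network (X i) (\<N> i)"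
  shows "Pytkeev_network (product_topology X I) (finite_cylinders X I (\<lambda>i. finite_unions (\<N> i)))"
    (is "Pytkeev_network ?P ?C")
  unfolding Pytkeev_network_def
proof (intro conjI ballI)
  show "?C \<subseteq> Pow (topspace ?P)" unfolding finite_cylinders_def cylinder_def by blast
next
  fix x assume x: "x \<in> topspace ?P"
  show "Pytkeev_network_at ?P ?C x"
    unfolding Pytkeev_network_at_def network_at_def
  proof (intro conjI allI impI)
    fix V assume "neighborhood_of ?P x V"
    then obtain F U where F: "finite F" "F \<subseteq> I" and U: "\<And>i. i \<in> F \<Longrightarrow> openin (X i) (U i)"
      and cyl: "x \<in> cylinder X I F U" "cylinder X I F U \<subseteq> V"
      by (rule neighborhood_of_product_cylinder) blast
    have "\<exists>N\<in>\<N> i. x i \<in> N \<and> N \<subseteq> U i" if "i \<in> F" for i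
    proof -
      have "x i \<in> U i" using cyl(1) that unfolding cylinder_def by blast
      moreover have "U i \<subseteq> topspace (X i)" using U[OF that] openin_subset by blast
      ultimately show ?thesis
        using assms(2)[of i] U[OF that] F(2) that
        unfolding Pytkeev_network_def Pytkeev_network_at_def network_at_def neighborhood_of_def
        by blast
    qed
    then obtain M where M: "\<And>i. i \<in> F \<Longrightarrow> M i \<in> \<N> i \<and> x i \<in> M i \<and> M i \<subseteq> U i" by metis
    have "cylinder X I F M \<in> ?C"
      using M by (intro cylinder_mem_finite_cylinders F mem_finite_unions) blast
    moreover have "x \<in> cylinder X I F M" using M x unfolding cylinder_def by blast
    moreover have "cylinder X I F M \<subseteq> V" using M cyl(2) unfolding cylinder_def by blast
    ultimately show "\<exists>N\<in>?C. x \<in> N \<and> N \<subseteq> V" by blast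
  next
    fix V A
    assume VA: "neighborhood_of ?P x V \<and> A \<subseteq> topspace ?P \<and> accumulates_at ?P A x"
    then have "neighborhood_of ?P x V" by blast
    then obtain F U where F: "finite F" "F \<subseteq> I" and U: "\<And>i. i \<in> F \<Longrightarrow> openin (X i) (U i)"
      and cyl: "x \<in> cylinder X I F U" "cylinder X I F U \<subseteq> V" "openin ?P (cylinder X I F U)"
      by (rule neighborhood_of_product_cylinder) blast
    define B where "B = A \<inter> cylinder X I F U"
    have B: "B \<subseteq> topspace ?P" "accumulates_at ?P B x"
    proof -
      show "B \<subseteq> topspace ?P" using VA unfolding B_def by blast
      have "accumulates_at ?P A x" using VA by blast
      then show "accumulates_at ?P B x"
        unfolding B_def using cyl(3,1) by (rule accumulates_at_Int_openin)
    qed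
    have "\<exists>r. Pytkeev_rank (X i) (U i) (x i) r \<and> (\<forall>n. {y \<in> U i. r y \<le> n} \<in> finite_unions (\<N> i))"
      if "i \<in> F" for i
    proof -
      have "i \<in> I" "x i \<in> U i" using that F(2) cyl(1) unfolding cylinder_def by blast+
      then show ?thesis
        using Pytkeev_network_rank[OF assms(1) assms(2) U[OF that]] by metis
    qed
    then obtain r where r: "\<And>i. i \<in> F \<Longrightarrow> Pytkeev_rank (X i) (U i) (x i) (r i)"
      "\<And>i n. i \<in> F \<Longrightarrow> {y \<in> U i. r i y \<le> n} \<in> finite_unions (\<N> i)" by metis
    have "\<exists>n. infinite {b \<in> B. \<forall>i\<in>F. r i (b i) \<le> n}"
    proof (cases "F = {}")
      case True
      \<comment> \<open>No coordinate is restricted, so it only remains to see that \<open>B\<close> is infinite.\<close>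
      have "infinite (topspace ?P \<inter> B)"
        using B(2) x unfolding accumulates_at_iff_openin by blast
      then have "infinite B" by blast
      then show ?thesis using True by simp
    next
      case False
      show ?thesis
      proof (rule common_rank_bound[where X = X and f = "\<lambda>i g. g i" and U = U, OF x B F(1) False])
        show "continuous_map ?P (X i) (\<lambda>g. g i)" if "i \<in> F" for i
          using that F(2) by (intro continuous_map_product_projection) blast
        show "(\<lambda>g. g i) ` B \<subseteq> U i" if "i \<in> F" for i
          using that unfolding B_def cylinder_def by blast
      qed (rule r(1))
    qed
    then obtain n where n: "infinite {b \<in> B. \<forall>i\<in>F. r i (b i) \<le> n}" by blast
    define N where "N = cylinder X I F (\<lambda>i. {y \<in> U i. r i y \<le> n})"
    have "N \<in> ?C" unfolding N_def by (intro cylinder_mem_finite_cylinders F r(2))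
    moreover have "N \<subseteq> V" using cyl(2) unfolding N_def cylinder_def by blast
    moreover have "{b \<in> B. \<forall>i\<in>F. r i (b i) \<le> n} \<subseteq> N \<inter> A"
      unfolding N_def B_def cylinder_def by blast
    then have "infinite (N \<inter> A)" using n infinite_super by blast
    ultimately show "\<exists>N\<in>?C. N \<subseteq> V \<and> infinite (N \<inter> A)" by blast
  qed
qed

theorem theorem3p5:
  fixes X :: "'i \<Rightarrow> 'a topology" and A :: "'i set"
  assumes "\<And>\<alpha>. \<alpha> \<in> A \<Longrightarrow> \<exists>\<N>. countable \<N> \<and> Pytkeev_network (X \<alpha>) \<N>"
    and "countable A"
  shows "\<exists>\<N>. countable \<N> \<and> Pytkeev_network (product_topology X A) \<N>"
proof -
  obtain \<N> where \<N>: "\<And>\<alpha>. \<alpha> \<in> A \<Longrightarrow> countable (\<N> \<alpha>)" "\<And>\<alpha>. \<alpha> \<in> A \<Longrightarrow> Pytkeev_network (X \<alpha>) (\<N> \<alpha>)"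
    using assms(1) by metis
  have "countable (finite_cylinders X A (\<lambda>\<alpha>. finite_unions (\<N> \<alpha>)))"
    using assms(2) \<N>(1) by (intro countable_finite_cylinders countable_finite_unions)
  moreover have "Pytkeev_network (product_topology X A)
      (finite_cylinders X A (\<lambda>\<alpha>. finite_unions (\<N> \<alpha>)))"
    using \<N> by (rule Pytkeev_network_product)
  ultimately show ?thesis by (intro exI conjI)
qed

end
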